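(* For any $\delta>0$, we have $R(g,n)>\left(\frac{2}{\sqrt\pi}-\delta\right)\sqrt{gn}$ if both $\frac{g}{\log n}$ and $\frac ng$ are sufficiently large in terms of $\delta$.
   Context: A set $S$ of integers is called a $B^\ast[g]$ set if for every integer $m$ there are at most $g$ ordered pairs $(s_1,s_2)\in S\times S$ with $s_1+s_2=m$. For positive integers $g,n$, $R(g,n)$ denotes the largest cardinality of a $B^\ast[g]$ set contained in $\{1,2,\dots,n\}$. *)

theory Defs
  imports "HOL-Analysis.Analysis"
begin

text \<open>The finiteness conjunct is needed because \<^term>\<open>card\<close> is 0 on infinite sets.\<close>

definition bstar_set :: "nat \<Rightarrow> int set \<Rightarrow> bool" where
  "bstar_set g S \<longleftrightarrow>
     (\<forall>m. finite {(s1, s2) \<in> S \<times> S. s1 + s2 = m} \<and>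
          card {(s1, s2) \<in> S \<times> S. s1 + s2 = m} \<le> g)"

definition R :: "nat \<Rightarrow> nat \<Rightarrow> nat" where
  "R g n = Max (card ` {S. S \<subseteq> {1..int n} \<and> bstar_set g S})"

text \<open>The maximum ranges over a finite nonempty set, so it is attained.\<close>

lemma finite_bstar_subsets: "finite {S. S \<subseteq> {1..int n} \<and> bstar_set g S}"
  by (rule finite_subset[of _ "Pow {1..int n}"]) auto

lemma bstar_subsets_nonempty: "{S. S \<subseteq> {1..int n} \<and> bstar_set g S} \<noteq> {}"
proof -
  have "bstar_set g {}"
    by (simp add: bstar_set_def)
  then show ?thesis
    by blast
qed

end

theory Submission
  imports Defs
begin

text \<open>
The set is chosen at random. Each integer k with g \<le> k \<le> n is put into S independently, with
probability p k = (1 - e) sqrt (g / (pi k)) for a small e > 0. The shape k powr (-1/2) is the right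
one because its autoconvolution is constant: the integral of 1 / sqrt (x (m - x)) over 0 < x < m is
pi for every m. Hence every m has, on average, at most about (1 - e)^2 g representations as an
ordered sum of two elements of S, so no capacity is wasted on small m, while the average size of S
is about 2 (1 - e) sqrt (g n / pi), which is the size wanted.

It remains to see that one S behaves like the average, simultaneously for its size and for all
the fewer than 2 n values of m that matter. For a fixed m, the pairs {k, m - k} with 2 k < m are
disjoint, so the number of pairs inside S is a sum of independent indicators, and so is the size
of S. Both are instances of counting which members of a disjoint family of blocks are contained in
S. The lemma mean_exp_card_blocks_le bounds the exponential moments of such a count by those of a
Poisson variable with the same mean, and this yields Chernoff bounds in both directions. Too many
pairs for a given m has a weight of order exp (- e^2 g / 2), which is at most n powr (-2) as soon as
g is a large multiple of ln n; this is where the growth of g / ln n is needed. The growth of n / g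
makes the loss negligible that comes from starting at k = g, where p k is safely below 1.

The two bounds are combined in exists_bstar_set by averaging one function of S which is the sum of
all the Chernoff exponentials: its mean is below 1, so it is below 1 for some S, and then each of
its terms is below 1.
\<close>

section \<open>Averages over random subsets\<close>

text \<open>
The expectation of F at a random subset of A that contains each k independently with probability
p k. All random sets here are finite, so a finite weighted sum suffices.
\<close>

definition mean :: "('a \<Rightarrow> real) \<Rightarrow> 'a set \<Rightarrow> ('a set \<Rightarrow> real) \<Rightarrow> real" where
  "mean p A F = (\<Sum>S\<in>Pow A. prod p S * (\<Prod>k\<in>A - S. 1 - p k) * F S)"

lemma mean_cong: "(\<And>S. S \<subseteq> A \<Longrightarrow> F S = G S) \<Longrightarrow> mean p A F = mean p A G"
  unfolding mean_def by (intro sum.cong) auto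

lemma mean_add: "mean p A (\<lambda>S. F S + G S) = mean p A F + mean p A G"
  unfolding mean_def by (simp add: sum.distrib distrib_left)

lemma mean_mult_left: "mean p A (\<lambda>S. c * F S) = c * mean p A F"
  unfolding mean_def by (simp add: sum_distrib_left mult_ac)

lemma mean_sum: "mean p A (\<lambda>S. \<Sum>i\<in>I. F i S) = (\<Sum>i\<in>I. mean p A (F i))"
  unfolding mean_def by (subst sum.swap) (simp add: sum_distrib_left)

lemma mean_const:
  assumes "finite A"
  shows "mean p A (\<lambda>_. c) = c"
proof -
  have "(\<Sum>S\<in>Pow A. prod p S * (\<Prod>k\<in>A - S. 1 - p k)) = (\<Prod>k\<in>A. p k + (1 - p k))"
    using prod_add[OF assms, of p "\<lambda>k. 1 - p k"] by simp
  then show ?thesis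
    unfolding mean_def by (simp flip: sum_distrib_right)
qed

lemma mean_mono:
  assumes "\<And>k. k \<in> A \<Longrightarrow> 0 \<le> p k \<and> p k \<le> 1"
    and "\<And>S. S \<subseteq> A \<Longrightarrow> F S \<le> G S"
  shows "mean p A F \<le> mean p A G"
  unfolding mean_def
proof (intro sum_mono mult_left_mono)
  fix S
  assume S: "S \<in> Pow A"
  then show "F S \<le> G S"
    using assms(2) by blast
  have "0 \<le> prod p S" "0 \<le> (\<Prod>k\<in>A - S. 1 - p k)"
    using assms(1) S by (fastforce intro: prod_nonneg)+
  then show "0 \<le> prod p S * (\<Prod>k\<in>A - S. 1 - p k)"
    by simp
qed

lemma ex_less_if_mean_less:
  assumes "finite A" "\<And>k. k \<in> A \<Longrightarrow> 0 \<le> p k \<and> p k \<le> 1" "mean p A F < c"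
  obtains S where "S \<subseteq> A" "F S < c"
proof (rule ccontr)
  assume "\<not> thesis"
  then have "c \<le> F S" if "S \<subseteq> A" for S
    using \<open>\<And>S. S \<subseteq> A \<Longrightarrow> F S < c \<Longrightarrow> thesis\<close> \<open>S \<subseteq> A\<close> by (meson not_le)
  then have "mean p A (\<lambda>_. c) \<le> mean p A F"
    by (intro mean_mono assms(2))
  then show False
    using assms(1,3) by (simp add: mean_const)
qed

lemma mean_contains:
  assumes "finite A"
  shows "mean p A (\<lambda>S. of_bool (A \<subseteq> S)) = prod p A"
proof -
  have "mean p A (\<lambda>S. of_bool (A \<subseteq> S)) = (\<Sum>S\<in>Pow A. if S = A then prod p A else 0)"
    unfolding mean_def by (intro sum.cong) auto
  then show ?thesis
    using assms by simp
qed

text \<open>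
Independence: the parts of the random set in disjoint sets are independent, because the weight of a
subset of A \<union> B is the product of the weights of its two parts.
\<close>

lemma mean_product_disjoint:
  assumes "finite A" "finite B" "A \<inter> B = {}"
  shows "mean p (A \<union> B) (\<lambda>S. F (S \<inter> A) * G (S \<inter> B)) = mean p A F * mean p B G"
proof -
  let ?w = "\<lambda>A S. prod p S * (\<Prod>k\<in>A - S. 1 - p k)"
  have w: "?w (A \<union> B) (S \<union> T) = ?w A S * ?w B T" if "S \<subseteq> A" "T \<subseteq> B" for S T
  proof -
    have "prod p (S \<union> T) = prod p S * prod p T"
      using that assms by (intro prod.union_disjoint) (auto intro: finite_subset)
    moreover have "A \<union> B - (S \<union> T) = (A - S) \<union> (B - T)"
      using that assms by auto
    moreover have "(\<Prod>k\<in>(A - S) \<union> (B - T). 1 - p k) = (\<Prod>k\<in>A - S. 1 - p k) * (\<Prod>k\<in>B - T. 1 - p k)"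
      using assms by (intro prod.union_disjoint) auto
    ultimately show ?thesis
      by simp
  qed
  have eq: "(S \<union> T) \<inter> A = S" "(S \<union> T) \<inter> B = T" if "S \<subseteq> A" "T \<subseteq> B" for S T
    using that assms by auto
  have "mean p (A \<union> B) (\<lambda>S. F (S \<inter> A) * G (S \<inter> B))
      = (\<Sum>(S, T)\<in>Pow A \<times> Pow B. ?w A S * F S * (?w B T * G T))"
    unfolding mean_def
  proof (rule sum.reindex_bij_witness[where i = "\<lambda>(S, T). S \<union> T" and j = "\<lambda>S. (S \<inter> A, S \<inter> B)"], goal_cases)
    case (5 S)
    then have "S = (S \<inter> A) \<union> (S \<inter> B)"
      by auto
    with w[of "S \<inter> A" "S \<inter> B"] show ?case
      by (simp add: mult_ac)
  qed (use assms in auto)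
  also have "\<dots> = mean p A F * mean p B G"
    unfolding mean_def by (simp add: sum_product sum.cartesian_product)
  finally show ?thesis .
qed

text \<open>
The source of both concentration estimates. The indicator of a block with containment probability q
has exponential moment 1 + (exp l - 1) q, which is at most exp ((exp l - 1) q), and independence
multiplies these bounds. The sign of l is arbitrary: positive l controls the upper tail of the
count, negative l the lower tail.
\<close>

lemma mean_exp_card_blocks_le:
  assumes "finite I" "finite A" "disjoint_family_on B I" "\<And>i. i \<in> I \<Longrightarrow> B i \<subseteq> A"
    and p: "\<And>k. k \<in> A \<Longrightarrow> 0 \<le> p k \<and> p k \<le> 1"
  shows "mean p A (\<lambda>S. exp (l * real (card {i \<in> I. B i \<subseteq> S})))
           \<le> exp ((exp l - 1) * (\<Sum>i\<in>I. prod p (B i)))"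
  using assms
proof (induction I arbitrary: A rule: finite_induct)
  case empty
  then show ?case
    by (simp add: mean_const)
next
  case (insert i I)
  let ?A = "A - B i"
  let ?F = "\<lambda>S. 1 + (exp l - 1) * of_bool (B i \<subseteq> S)"
  let ?G = "\<lambda>S. exp (l * real (card {j \<in> I. B j \<subseteq> S}))"
  have Bi: "B i \<subseteq> A" "finite (B i)"
    using insert.prems finite_subset by blast+
  have decomp: "B i \<union> ?A = A"
    using Bi by auto
  have dj: "B j \<inter> B i = {}" if "j \<in> I" for j
    using insert.prems(2) insert.hyps that by (auto simp: disjoint_family_on_def)
  have split: "exp (l * real (card {j \<in> insert i I. B j \<subseteq> S})) = ?F (S \<inter> B i) * ?G (S \<inter> ?A)"
    if "S \<subseteq> A" for S
  proof -
    have "{j \<in> I. B j \<subseteq> S} = {j \<in> I. B j \<subseteq> S \<inter> ?A}"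
      using dj insert.prems(3) by blast
    moreover have "card {j \<in> insert i I. B j \<subseteq> S} = of_bool (B i \<subseteq> S) + card {j \<in> I. B j \<subseteq> S}"
    proof (cases "B i \<subseteq> S")
      case True
      then have "{j \<in> insert i I. B j \<subseteq> S} = insert i {j \<in> I. B j \<subseteq> S}"
        by auto
      then show ?thesis
        using True insert.hyps by simp
    next
      case False
      then have "{j \<in> insert i I. B j \<subseteq> S} = {j \<in> I. B j \<subseteq> S}"
        by auto
      then show ?thesis
        using False by simp
    qed
    ultimately show ?thesis
      by (simp add: distrib_left exp_add)
  qed
  have "mean p A (\<lambda>S. exp (l * real (card {j \<in> insert i I. B j \<subseteq> S})))
      = mean p (B i \<union> ?A) (\<lambda>S. ?F (S \<inter> B i) * ?G (S \<inter> ?A))"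
    unfolding decomp by (intro mean_cong split)
  also have "\<dots> = mean p (B i) ?F * mean p ?A ?G"
    using insert.prems(1) Bi by (intro mean_product_disjoint) auto
  also have "mean p (B i) ?F = 1 + (exp l - 1) * prod p (B i)"
    by (simp only: mean_add mean_mult_left mean_const[OF Bi(2)] mean_contains[OF Bi(2)])
  also have "(1 + (exp l - 1) * prod p (B i)) * mean p ?A ?G
      \<le> exp ((exp l - 1) * prod p (B i)) * exp ((exp l - 1) * (\<Sum>j\<in>I. prod p (B j)))"
  proof (intro mult_mono)
    show "1 + (exp l - 1) * prod p (B i) \<le> exp ((exp l - 1) * prod p (B i))"
      by (rule exp_ge_add_one_self)
    show "mean p ?A ?G \<le> exp ((exp l - 1) * (\<Sum>j\<in>I. prod p (B j)))"
      using insert.prems(1,4)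
    proof (intro insert.IH)
      show "disjoint_family_on B I"
        using insert.prems(2) by (auto simp: disjoint_family_on_def)
      show "B j \<subseteq> ?A" if "j \<in> I" for j
        using insert.prems(3) dj[OF that] that by blast
    qed auto
    show "0 \<le> mean p ?A ?G"
      using mean_mono[of ?A p "\<lambda>_. 0" ?G] mean_const[of ?A p 0] insert.prems by auto
  qed auto
  also have "\<dots> = exp ((exp l - 1) * (\<Sum>j\<in>insert i I. prod p (B j)))"
    using insert.hyps by (simp add: distrib_left exp_add)
  finally show ?case .
qed

section \<open>Sums against the inverse square root density\<close>

text \<open>
The function z \<mapsto> arcsin (2 z / m - 1) is an antiderivative of 1 / sqrt (z (m - z)), which
decreases on (0, m / 2); so its value at x is at most its integral over [x - 1, x]. The mean value
theorem needs the derivative only in the interior, which matters for x = 1, where the integrand has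
a pole at the left end.
\<close>

lemma arcsin_increment_ge:
  fixes x m :: real
  assumes "1 \<le> x" "2 * x \<le> m"
  shows "1 / sqrt (x * (m - x)) \<le> arcsin (2 * x / m - 1) - arcsin (2 * (x - 1) / m - 1)"
proof -
  have m: "m > 0"
    using assms by linarith
  have deriv: "((\<lambda>z. arcsin (2 * z / m - 1)) has_real_derivative
      inverse (sqrt (1 - (2 * z / m - 1)\<^sup>2)) * (2 / m)) (at z)" if "x - 1 < z" "z < x" for z
  proof -
    have "-1 < 2 * z / m - 1" "2 * z / m - 1 < 1"
      using assms m that by (auto simp: field_simps)
    then show ?thesis
      using m by (auto intro!: derivative_eq_intros)
  qed
  have "\<exists>l z. x - 1 < z \<and> z < x \<and>
      ((\<lambda>z. arcsin (2 * z / m - 1)) has_real_derivative l) (at z) \<and>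
      arcsin (2 * x / m - 1) - arcsin (2 * (x - 1) / m - 1) = (x - (x - 1)) * l"
  proof (rule MVT)
    show "continuous_on {x - 1..x} (\<lambda>z. arcsin (2 * z / m - 1))"
      using assms m by (intro continuous_intros) (auto simp: field_simps)
    show "(\<lambda>z. arcsin (2 * z / m - 1)) differentiable (at z)" if "x - 1 < z" "z < x" for z
      using deriv[OF that] real_differentiable_def by blast
  qed auto
  then obtain l z where z: "x - 1 < z" "z < x"
    and l: "((\<lambda>z. arcsin (2 * z / m - 1)) has_real_derivative l) (at z)"
    and eq: "arcsin (2 * x / m - 1) - arcsin (2 * (x - 1) / m - 1) = l"
    by auto
  have "l = inverse (sqrt (1 - (2 * z / m - 1)\<^sup>2)) * (2 / m)"
    using l deriv[OF z] DERIV_unique by blast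
  also have "1 - (2 * z / m - 1)\<^sup>2 = (2 / m)\<^sup>2 * (z * (m - z))"
    using m by (simp add: field_simps power2_eq_square)
  also have "sqrt \<dots> = 2 / m * sqrt (z * (m - z))"
    using m by (simp add: real_sqrt_mult)
  finally have "l = 1 / sqrt (z * (m - z))"
    using m by (simp add: field_simps)
  moreover have "1 / sqrt (x * (m - x)) \<le> 1 / sqrt (z * (m - z))"
  proof (intro divide_left_mono)
    have "0 \<le> (x - z) * (m - x - z)"
      using z assms by (intro mult_nonneg_nonneg) auto
    then show "sqrt (z * (m - z)) \<le> sqrt (x * (m - x))"
      by (simp add: algebra_simps)
    show "0 < sqrt (x * (m - x)) * sqrt (z * (m - z))"
      using z assms m by (auto intro!: mult_pos_pos)
  qed auto
  ultimately show ?thesis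
    using eq by simp
qed

text \<open>
The increments of the arcsine telescope; the bound is its total increase from -1 to 0. There is no
error term, so the estimate is equally good for small m.
\<close>

lemma sum_inverse_sqrt_product_le:
  fixes m :: int
  shows "(\<Sum>k\<in>{k. 0 < k \<and> 2 * k < m}. 1 / sqrt (real_of_int k * (real_of_int m - real_of_int k))) \<le> pi / 2"
proof (cases "0 < m")
  case True
  let ?f = "\<lambda>k. 1 / sqrt (real_of_int k * (real_of_int m - real_of_int k))"
  have partial: "(\<Sum>k\<in>{1..j}. ?f k) \<le> arcsin (2 * real_of_int j / real_of_int m - 1) + pi / 2"
    if "0 \<le> j" "2 * j < m" for j
    using that
  proof (induction j rule: int_ge_induct)
    case base
    then show ?case
      by simp
  next
    case (step j)
    have "{1..j + 1} = insert (j + 1) {1..j}"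
      using step.hyps by auto
    then have "(\<Sum>k\<in>{1..j + 1}. ?f k) = ?f (j + 1) + (\<Sum>k\<in>{1..j}. ?f k)"
      by simp
    moreover have "2 * real_of_int (j + 1) \<le> real_of_int m"
      using step.prems by linarith
    then have "?f (j + 1) \<le> arcsin (2 * real_of_int (j + 1) / real_of_int m - 1)
        - arcsin (2 * (real_of_int (j + 1) - 1) / real_of_int m - 1)"
      using step.hyps by (intro arcsin_increment_ge) auto
    ultimately show ?case
      using step by simp
  qed
  have below: "2 * ((m - 1) div 2) < m"
    by presburger
  have "{k. 0 < k \<and> 2 * k < m} = {1..(m - 1) div 2}"
    by auto
  moreover have "arcsin (2 * real_of_int ((m - 1) div 2) / real_of_int m - 1) \<le> arcsin 0"
  proof (rule arcsin_le_arcsin)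
    have "0 \<le> (m - 1) div 2" "2 * ((m - 1) div 2) \<le> m"
      using True by auto
    then have "0 \<le> 2 * real_of_int ((m - 1) div 2)" "2 * real_of_int ((m - 1) div 2) \<le> real_of_int m"
      by linarith+
    then show "2 * real_of_int ((m - 1) div 2) / real_of_int m - 1 \<le> 0"
      "-1 \<le> 2 * real_of_int ((m - 1) div 2) / real_of_int m - 1"
      using True by (simp_all add: field_simps)
  qed auto
  ultimately show ?thesis
    using partial[of "(m - 1) div 2"] True by (simp add: below)
next
  case False
  then have "{k. 0 < k \<and> 2 * k < m} = {}"
    by auto
  then show ?thesis
    by (simp only: sum.empty) simp
qed

lemma sum_inverse_sqrt_ge:
  fixes a b :: int
  assumes "0 < a" "a \<le> b"
  shows "2 * (sqrt (real_of_int b) - sqrt (real_of_int a)) \<le> (\<Sum>k\<in>{a..b}. 1 / sqrt (real_of_int k))"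
proof -
  have incr: "2 * (sqrt (x + 1) - sqrt x) \<le> 1 / sqrt x" if "0 < x" for x :: real
  proof -
    have "0 \<le> (sqrt (x + 1) - sqrt x)\<^sup>2"
      by simp
    also have "\<dots> = 2 * x + 1 - 2 * sqrt (x + 1) * sqrt x"
      using that by (simp add: power2_diff)
    finally have "2 * (sqrt (x + 1) - sqrt x) * sqrt x \<le> 1"
      using that by (simp add: left_diff_distrib right_diff_distrib mult.assoc)
    then show ?thesis
      using that by (simp add: pos_le_divide_eq)
  qed
  have "2 * (sqrt (real_of_int b + 1) - sqrt (real_of_int a)) \<le> (\<Sum>k\<in>{a..b}. 1 / sqrt (real_of_int k))"
    using assms(2)
  proof (induction b rule: int_ge_induct)
    case base
    show ?case
      using incr[of "real_of_int a"] assms by simp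
  next
    case (step b)
    have "{a..b + 1} = insert (b + 1) {a..b}"
      using step.hyps by auto
    then have "(\<Sum>k\<in>{a..b + 1}. 1 / sqrt (real_of_int k))
        = 1 / sqrt (real_of_int b + 1) + (\<Sum>k\<in>{a..b}. 1 / sqrt (real_of_int k))"
      by simp
    then show ?case
      using incr[of "real_of_int b + 1"] step assms by (simp add: algebra_simps)
  qed
  then show ?thesis
    by (rule order_trans[rotated]) simp
qed

section \<open>Counting representations\<close>

text \<open>
The pairs with s < t and those with t < s are mirror images, and at most one pair has s = t.
\<close>

lemma card_representations_le:
  fixes S :: "int set" and m :: int
  assumes "finite S"
  shows "card {(s, t) \<in> S \<times> S. s + t = m}
           \<le> 2 * card {k. 2 * k < m \<and> k \<in> S \<and> m - k \<in> S} + 1"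
proof -
  let ?L = "{k. 2 * k < m \<and> k \<in> S \<and> m - k \<in> S}"
  have fin: "finite ?L"
    using assms by (auto intro: finite_subset[of _ S])
  have "{(s, t) \<in> S \<times> S. s + t = m}
      \<subseteq> (\<lambda>k. (k, m - k)) ` ?L \<union> (\<lambda>k. (m - k, k)) ` ?L \<union> {(m div 2, m div 2)}" (is "_ \<subseteq> ?U \<union> ?V \<union> ?D")
  proof (intro subsetI)
    fix x
    assume "x \<in> {(s, t) \<in> S \<times> S. s + t = m}"
    then obtain s where x: "x = (s, m - s)" and s: "s \<in> S" "m - s \<in> S"
      by force
    consider "2 * s < m" | "2 * s = m" | "2 * (m - s) < m"
      by force
    then show "x \<in> ?U \<union> ?V \<union> ?D"
    proof cases
      case 1
      then show ?thesis
        using x s by blast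
    next
      case 2
      then show ?thesis
        using x by auto
    next
      case 3
      then have "m - s \<in> ?L"
        using s by simp
      moreover have "x = (\<lambda>k. (m - k, k)) (m - s)"
        using x by simp
      ultimately have "x \<in> ?V"
        by (rule rev_image_eqI)
      then show ?thesis
        by blast
    qed
  qed
  then have "card {(s, t) \<in> S \<times> S. s + t = m} \<le> card (?U \<union> ?V \<union> ?D)"
    using fin by (intro card_mono) auto
  also have "\<dots> \<le> card ?U + card ?V + card ?D"
    by (meson card_Un_le add_le_mono1 order_trans)
  also have "\<dots> \<le> 2 * card ?L + 1"
    using card_image_le[OF fin, of "\<lambda>k. (k, m - k)"] card_image_le[OF fin, of "\<lambda>k. (m - k, k)"] by simp
  finally show ?thesis .
qed

section \<open>Exponential moments of the size and of the representation counts\<close>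

text \<open>The size of S counts the singleton blocks that it contains.\<close>

lemma mean_exp_card_le:
  assumes "finite A" and p: "\<And>k. k \<in> A \<Longrightarrow> 0 \<le> p k \<and> p k \<le> 1"
  shows "mean p A (\<lambda>S. exp (l * real (card S))) \<le> exp ((exp l - 1) * sum p A)"
proof -
  have "mean p A (\<lambda>S. exp (l * real (card S)))
      = mean p A (\<lambda>S. exp (l * real (card {k \<in> A. {k} \<subseteq> S})))"
  proof (intro mean_cong)
    fix S
    assume "S \<subseteq> A"
    then have "{k \<in> A. {k} \<subseteq> S} = S"
      by auto
    then show "exp (l * real (card S)) = exp (l * real (card {k \<in> A. {k} \<subseteq> S}))"
      by (simp only:)
  qed
  also have "\<dots> \<le> exp ((exp l - 1) * (\<Sum>k\<in>A. prod p {k}))"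
    using assms by (intro mean_exp_card_blocks_le) (auto simp: disjoint_family_on_def)
  finally show ?thesis
    by simp
qed

text \<open>
The two-element blocks {k, m - k} with 2 k < m are disjoint, and the choice of p turns their total
containment probability into the arcsine sum.
\<close>

lemma mean_exp_card_half_representations_le:
  fixes A :: "int set" and m :: int
  assumes "finite A" "A \<subseteq> {0<..}" and p_def: "\<And>k. p k = a / sqrt (real_of_int k)"
    and p: "\<And>k. k \<in> A \<Longrightarrow> 0 \<le> p k \<and> p k \<le> 1" and "0 \<le> l"
  shows "mean p A (\<lambda>S. exp (l * real (card {k. 2 * k < m \<and> k \<in> S \<and> m - k \<in> S})))
           \<le> exp ((exp l - 1) * (a\<^sup>2 * (pi / 2)))"
proof -
  let ?I = "{k. 2 * k < m \<and> k \<in> A \<and> m - k \<in> A}"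
  let ?J = "{k. 0 < k \<and> 2 * k < m}"
  have "?J \<subseteq> {0..m}"
    by auto
  then have J: "finite ?J" "?I \<subseteq> ?J"
    using assms(2) finite_subset by blast+
  \<comment> \<open>The two elements of a block are distinct because 2 * k < m.\<close>
  have "(\<Sum>k\<in>?I. prod p {k, m - k})
      = (\<Sum>k\<in>?I. a\<^sup>2 * (1 / sqrt (real_of_int k * (real_of_int m - real_of_int k))))"
    by (intro sum.cong) (auto simp: p_def real_sqrt_mult power2_eq_square)
  also have "\<dots> \<le> (\<Sum>k\<in>?J. a\<^sup>2 * (1 / sqrt (real_of_int k * (real_of_int m - real_of_int k))))"
  proof (intro sum_mono2)
    fix k
    assume "k \<in> ?J - ?I"
    then have "0 < real_of_int k" "0 < real_of_int m - real_of_int k"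
      by auto
    then show "0 \<le> a\<^sup>2 * (1 / sqrt (real_of_int k * (real_of_int m - real_of_int k)))"
      by simp
  qed (use J in auto)
  also have "\<dots> \<le> a\<^sup>2 * (pi / 2)"
    unfolding sum_distrib_left[symmetric]
    by (intro mult_left_mono sum_inverse_sqrt_product_le) auto
  finally have pairs: "(\<Sum>k\<in>?I. prod p {k, m - k}) \<le> a\<^sup>2 * (pi / 2)" .
  have "mean p A (\<lambda>S. exp (l * real (card {k. 2 * k < m \<and> k \<in> S \<and> m - k \<in> S})))
      = mean p A (\<lambda>S. exp (l * real (card {k \<in> ?I. {k, m - k} \<subseteq> S})))"
  proof (intro mean_cong)
    fix S
    assume "S \<subseteq> A"
    then have "{k \<in> ?I. {k, m - k} \<subseteq> S} = {k. 2 * k < m \<and> k \<in> S \<and> m - k \<in> S}"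
      by auto
    then show "exp (l * real (card {k. 2 * k < m \<and> k \<in> S \<and> m - k \<in> S}))
        = exp (l * real (card {k \<in> ?I. {k, m - k} \<subseteq> S}))"
      by (simp only:)
  qed
  also have "\<dots> \<le> exp ((exp l - 1) * (\<Sum>k\<in>?I. prod p {k, m - k}))"
    using assms(1) p finite_subset[OF J(2,1)]
    by (intro mean_exp_card_blocks_le) (auto simp: disjoint_family_on_def)
  also have "\<dots> \<le> exp ((exp l - 1) * (a\<^sup>2 * (pi / 2)))"
    using pairs \<open>0 \<le> l\<close> by (subst exp_le_cancel_iff, intro mult_left_mono) auto
  finally show ?thesis .
qed

lemma exp_minus_le_quadratic:
  fixes x :: real
  assumes "0 \<le> x"
  shows "exp (- x) \<le> 1 - x + x\<^sup>2 / 2"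
proof -
  have pos: "0 < 1 - x + x\<^sup>2 / 2"
  proof -
    have "0 \<le> (1 - x)\<^sup>2"
      by simp
    then show ?thesis
      by (simp add: power2_diff)
  qed
  \<comment> \<open>The product is 1 + x ^ 4 / 4.\<close>
  have "1 \<le> (1 - x + x\<^sup>2 / 2) * (1 + x + x\<^sup>2 / 2)"
    using assms by (simp add: algebra_simps power2_eq_square)
  also have "\<dots> \<le> (1 - x + x\<^sup>2 / 2) * exp x"
    using pos exp_lower_Taylor_quadratic[OF assms] by (intro mult_left_mono) auto
  finally show ?thesis
    by (simp add: exp_minus field_simps)
qed

lemma bstar_set_if_half_representations_le:
  fixes S :: "int set"
  assumes "S \<subseteq> {1..int n}"
    and half: "\<And>m. 2 \<le> m \<Longrightarrow> m \<le> 2 * int n \<Longrightarrow>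
          2 * card {k. 2 * k < m \<and> k \<in> S \<and> m - k \<in> S} + 1 \<le> g"
  shows "bstar_set g S"
  unfolding bstar_set_def
proof (intro allI conjI)
  fix m
  have fin: "finite S"
    using assms(1) finite_subset by blast
  then show "finite {(s1, s2) \<in> S \<times> S. s1 + s2 = m}"
    by (auto intro: finite_subset[of _ "S \<times> S"])
  show "card {(s1, s2) \<in> S \<times> S. s1 + s2 = m} \<le> g"
  proof (cases "2 \<le> m \<and> m \<le> 2 * int n")
    case True
    then show ?thesis
      using card_representations_le[OF fin, of m] half[of m] by linarith
  next
    case False
    have "{(s1, s2) \<in> S \<times> S. s1 + s2 = m} = {}"
    proof -
      have False if "s \<in> S" "t \<in> S" "m = s + t" for s t
        using False that assms(1) by (force dest!: subsetD[OF assms(1)])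
      then show ?thesis
        by blast
    qed
    then show ?thesis
      by (simp only: card.empty)
  qed
qed

section \<open>The probabilistic construction\<close>

text \<open>
The Chernoff parameter is e for the upper tails and -e for the lower tail. With a second-order bound
on the exponential, the slack factor (1 - e)^2 in the mean number of pairs beats the error
factor 1 + e. One factor 1 - e in the final size comes from the density, one from the cut-off at g,
and one from the deviation allowed below the mean size.
\<close>

lemma exists_bstar_set:
  fixes e :: real and g n :: nat
  assumes e: "0 < e" "e \<le> 1 / 2" and "0 < g" "0 < n"
    and ratio: "64 / e ^ 4 < real n / real g"
    and log: "4 / e\<^sup>2 * ln (real n) < real g"
  obtains S where "S \<subseteq> {1..int n}" "bstar_set g S"
    "2 / sqrt pi * (1 - e) ^ 3 * sqrt (real g * real n) < real (card S)"
proof -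
  define a where "a = (1 - e) * sqrt (real g / pi)"
  define p where "p = (\<lambda>k. a / sqrt (real_of_int k))"
  let ?A = "{int g..int n}"
  define M where "M = sum p ?A"
  have e4: "e ^ 4 \<le> 1 / 16" "0 < e ^ 4"
    using power_mono[of e "1/2" 4] e by (auto simp: power_divide)
  have gn: "64 * real g < e ^ 4 * real n"
    using ratio e \<open>0 < g\<close> by (simp add: field_simps)
  have n_large: "1024 \<le> real n"
  proof -
    have "1 \<le> real g"
      using \<open>0 < g\<close> by simp
    then have "64 \<le> e ^ 4 * real n"
      using gn by linarith
    also have "\<dots> \<le> 1 / 16 * real n"
      using e4 by (intro mult_right_mono) auto
    finally show ?thesis
      by simp
  qed
  have "real g \<le> real n"
    using gn mult_right_mono[OF e4(1), of "real n"] by simp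
  then have "g \<le> n"
    by simp
  have a: "0 \<le> a" "a\<^sup>2 = (1 - e)\<^sup>2 * (real g / pi)"
    using e by (auto simp: a_def power_mult_distrib)
  have p: "0 \<le> p k \<and> p k \<le> 1" if "k \<in> ?A" for k
  proof -
    have "real g / pi \<le> real g"
      using pi_ge_two mult_right_mono[of 1 pi "real g"] by (simp add: field_simps)
    also have "real g \<le> real_of_int k"
      using that by simp
    finally have "sqrt (real g / pi) \<le> sqrt (real_of_int k)"
      by simp
    moreover have "(1 - e) * sqrt (real g / pi) \<le> 1 * sqrt (real g / pi)"
      using e by (intro mult_right_mono) auto
    ultimately have "a \<le> sqrt (real_of_int k)"
      unfolding a_def by (metis mult_1 order_trans)
    moreover have "0 < real_of_int k"
      using that \<open>0 < g\<close> by simp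
    ultimately show ?thesis
      using a(1) by (simp add: p_def)
  qed

  have M: "2 / sqrt pi * (1 - e)\<^sup>2 * sqrt (real g * real n) \<le> M"
  proof -
    have "real g \<le> e\<^sup>2 * real n"
    proof -
      have "real g \<le> e ^ 4 * real n"
        using gn by simp
      also have "\<dots> \<le> e\<^sup>2 * real n"
        using e by (intro mult_right_mono power_decreasing) auto
      finally show ?thesis .
    qed
    then have "sqrt (real g) \<le> sqrt (e\<^sup>2 * real n)"
      by (rule real_sqrt_le_mono)
    then have root: "sqrt (real g) \<le> e * sqrt (real n)"
      using e by (simp add: real_sqrt_mult)
    have "2 / sqrt pi * (1 - e)\<^sup>2 * sqrt (real g * real n) = a * (2 * ((1 - e) * sqrt (real n)))"
      by (simp add: a_def real_sqrt_mult real_sqrt_divide power2_eq_square)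
    also have "\<dots> \<le> a * (2 * (sqrt (real n) - sqrt (real g)))"
      using root a(1) by (intro mult_left_mono) (auto simp: algebra_simps)
    also have "\<dots> \<le> a * (\<Sum>k\<in>?A. 1 / sqrt (real_of_int k))"
      using sum_inverse_sqrt_ge[of "int g" "int n"] \<open>0 < g\<close> \<open>g \<le> n\<close> a(1) by (intro mult_left_mono) auto
    also have "\<dots> = M"
      by (simp add: M_def p_def sum_distrib_left)
    finally show ?thesis .
  qed
  have M_large: "2 / e\<^sup>2 \<le> M"
  proof -
    have "(8 / e\<^sup>2)\<^sup>2 = 64 / e ^ 4"
      by (simp add: power_divide)
    also have "\<dots> \<le> real g * real n"
    proof -
      have "1 \<le> real g"
        using \<open>0 < g\<close> by simp
      then have "real n / real g \<le> real n / 1" "1 * real n \<le> real g * real n"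
        by (intro divide_left_mono mult_right_mono; simp)+
      then show ?thesis
        using ratio by linarith
    qed
    finally have "8 / e\<^sup>2 \<le> sqrt (real g * real n)"
      by (rule real_le_rsqrt)
    moreover have "1 / 4 \<le> (1 - e)\<^sup>2"
      using power_mono[of "1/2" "1 - e" 2] e by (simp add: power_divide)
    moreover have "1 \<le> 2 / sqrt pi"
      using real_sqrt_le_mono[of pi 4] pi_less_4 by simp
    ultimately have "1 * (1 / 4) * (8 / e\<^sup>2) \<le> 2 / sqrt pi * (1 - e)\<^sup>2 * sqrt (real g * real n)"
      using e by (intro mult_mono) auto
    then show ?thesis
      using M by simp
  qed

  let ?L = "\<lambda>m S. real (card {k. 2 * k < m \<and> k \<in> S \<and> m - k \<in> S})"
  \<comment> \<open>The threshold (g - 1) / 2 leaves room for the representation m = k + k.\<close>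
  have pairs: "mean p ?A (\<lambda>S. exp (e * (?L m S - (real g - 1) / 2))) \<le> 2 / (real n)\<^sup>2" for m
  proof -
    have "mean p ?A (\<lambda>S. exp (e * (?L m S - (real g - 1) / 2)))
        = exp (- (e * ((real g - 1) / 2))) * mean p ?A (\<lambda>S. exp (e * ?L m S))"
      by (simp flip: mean_mult_left exp_add add: algebra_simps)
    also have "\<dots> \<le> exp (- (e * ((real g - 1) / 2))) * exp ((exp e - 1) * (a\<^sup>2 * (pi / 2)))"
      using e p \<open>0 < g\<close>
      by (intro mult_left_mono mean_exp_card_half_representations_le) (auto simp: p_def)
    also have "\<dots> = exp ((exp e - 1) * ((1 - e)\<^sup>2 * (real g / 2)) - e * ((real g - 1) / 2))"
      by (simp add: a(2) flip: exp_add)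
    also have "\<dots> \<le> exp (e / 2 + - (2 * ln (real n)))"
    proof (subst exp_le_cancel_iff)
      have "(exp e - 1) * (1 - e)\<^sup>2 \<le> (e + e\<^sup>2) * (1 - e)\<^sup>2"
        using exp_bound[of e] e by (intro mult_right_mono) auto
      also have "\<dots> = e * (1 - e) * (1 - e\<^sup>2)"
        by (simp add: algebra_simps power2_eq_square)
      also have "\<dots> \<le> e * (1 - e) * 1"
        using e by (intro mult_left_mono) auto
      finally have "(exp e - 1) * (1 - e)\<^sup>2 * (real g / 2) \<le> e * (1 - e) * (real g / 2)"
        by (intro mult_right_mono) auto
      moreover have "e * (1 - e) * (real g / 2) - e * ((real g - 1) / 2) = e / 2 - e\<^sup>2 * real g / 2"
        by (simp add: field_simps power2_eq_square)
      moreover have "4 * ln (real n) \<le> e\<^sup>2 * real g"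
        using log e by (simp add: field_simps)
      ultimately show "(exp e - 1) * ((1 - e)\<^sup>2 * (real g / 2)) - e * ((real g - 1) / 2)
          \<le> e / 2 + - (2 * ln (real n))"
        by (simp add: mult.assoc)
    qed
    also have "\<dots> = exp (e / 2) * (1 / (real n)\<^sup>2)"
    proof -
      have "exp (2 * ln (real n)) = (real n)\<^sup>2"
        using \<open>0 < n\<close> exp_of_nat_mult[of 2 "ln (real n)"] by simp
      then show ?thesis
        by (simp only: exp_add exp_minus inverse_eq_divide)
    qed
    also have "\<dots> \<le> 2 * (1 / (real n)\<^sup>2)"
    proof (intro mult_right_mono)
      have "exp (e / 2) \<le> 1 + e / 2 + (e / 2)\<^sup>2"
        using e by (intro exp_bound) auto
      also have "\<dots> \<le> 1 + 1 / 4 + (1 / 2)\<^sup>2"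
        using e by (intro add_mono power_mono) auto
      finally show "exp (e / 2) \<le> 2"
        by (simp add: power_divide)
    qed auto
    finally show ?thesis
      by simp
  qed
  have size: "mean p ?A (\<lambda>S. exp (e * ((1 - e) * M - real (card S)))) < 1 / 2"
  proof -
    have "mean p ?A (\<lambda>S. exp (e * ((1 - e) * M - real (card S))))
        = exp (e * (1 - e) * M) * mean p ?A (\<lambda>S. exp (- e * real (card S)))"
      by (simp flip: mean_mult_left exp_add add: algebra_simps)
    also have "\<dots> \<le> exp (e * (1 - e) * M) * exp ((exp (- e) - 1) * M)"
      unfolding M_def using p by (intro mult_left_mono mean_exp_card_le) auto
    also have "\<dots> = exp ((exp (- e) - 1 + e * (1 - e)) * M)"
      by (simp add: algebra_simps flip: exp_add)
    also have "\<dots> \<le> exp (- 1)"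
    proof (subst exp_le_cancel_iff)
      have "0 \<le> M"
        using M_large e by (smt (verit) divide_nonneg_nonneg zero_le_power2)
      then have "(exp (- e) - 1 + e * (1 - e)) * M \<le> (- (e\<^sup>2 / 2)) * M"
        using exp_minus_le_quadratic[of e] e
        by (intro mult_right_mono) (auto simp: algebra_simps power2_eq_square)
      also have "\<dots> \<le> - 1"
        using M_large e by (simp add: field_simps)
      finally show "(exp (- e) - 1 + e * (1 - e)) * M \<le> - 1" .
    qed
    also have "exp (- 1) < (1 / 2 :: real)"
      using exp_lower_Taylor_quadratic[of 1] by (simp add: exp_minus field_simps)
    finally show ?thesis .
  qed

  \<comment> \<open>Each summand of F is at least 1 whenever S violates the corresponding requirement.\<close>
  let ?F = "\<lambda>S. (\<Sum>m\<in>{2..2 * int n}. exp (e * (?L m S - (real g - 1) / 2)))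
      + exp (e * ((1 - e) * M - real (card S)))"
  have "mean p ?A ?F < 1"
  proof -
    have "(\<Sum>m\<in>{2..2 * int n}. mean p ?A (\<lambda>S. exp (e * (?L m S - (real g - 1) / 2))))
        \<le> real (card {2..2 * int n}) * (2 / (real n)\<^sup>2)"
      by (intro sum_bounded_above pairs)
    also have "\<dots> \<le> 2 * real n * (2 / (real n)\<^sup>2)"
      using \<open>0 < n\<close> by (intro mult_right_mono) auto
    also have "\<dots> \<le> 1 / 2"
      using n_large by (simp add: field_simps power2_eq_square)
    finally show ?thesis
      using size by (simp add: mean_add mean_sum)
  qed
  then obtain S where S: "S \<subseteq> ?A" "?F S < 1"
    using ex_less_if_mean_less[of ?A p ?F 1] p by blast
  have half: "2 * card {k. 2 * k < m \<and> k \<in> S \<and> m - k \<in> S} + 1 \<le> g" if "2 \<le> m" "m \<le> 2 * int n" for m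
  proof -
    have "exp (e * (?L m S - (real g - 1) / 2))
        \<le> (\<Sum>m\<in>{2..2 * int n}. exp (e * (?L m S - (real g - 1) / 2)))"
      using that by (intro member_le_sum) auto
    then have "exp (e * (?L m S - (real g - 1) / 2)) < exp 0"
      using S(2) exp_gt_zero[of "e * ((1 - e) * M - real (card S))"] by (simp only: exp_zero)
    then have "?L m S < (real g - 1) / 2"
      using e by (simp add: mult_less_0_iff)
    then show ?thesis
      by simp
  qed
  have sub: "S \<subseteq> {1..int n}"
    using S(1) \<open>0 < g\<close> by auto
  show thesis
  proof (rule that[OF sub bstar_set_if_half_representations_le[OF sub half]])
    have "0 \<le> (\<Sum>m\<in>{2..2 * int n}. exp (e * (?L m S - (real g - 1) / 2)))"
      by (intro sum_nonneg) auto
    then have "exp (e * ((1 - e) * M - real (card S))) < exp 0"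
      using S(2) by (simp only: exp_zero)
    then have "(1 - e) * M < real (card S)"
      using e by (simp add: mult_less_0_iff)
    moreover have "2 / sqrt pi * (1 - e) ^ 3 * sqrt (real g * real n) \<le> (1 - e) * M"
      using mult_left_mono[OF M, of "1 - e"] e by (simp add: power3_eq_cube power2_eq_square mult_ac)
    ultimately show "2 / sqrt pi * (1 - e) ^ 3 * sqrt (real g * real n) < real (card S)"
      by linarith
  qed
qed

theorem theorem1p4:
  fixes \<delta> :: real
  assumes "\<delta> > 0"
  shows "\<exists>K::real. \<forall>g n :: nat. g > 0 \<longrightarrow> n > 0 \<longrightarrow>
           real g / ln (real n) > K \<longrightarrow> real n / real g > K \<longrightarrow>
           real (R g n) > (2 / sqrt pi - \<delta>) * sqrt (real g * real n)"
proof -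
  \<comment> \<open>The loss is at most 2 / sqrt pi * 3 * e, and 2 / sqrt pi \<le> 2.\<close>
  define e where "e = min (1 / 2) (\<delta> / 6)"
  have e: "0 < e" "e \<le> 1 / 2" "6 * e \<le> \<delta>"
    using assms by (auto simp: e_def)
  have "2 / sqrt pi - \<delta> \<le> 2 / sqrt pi * (1 - e) ^ 3"
  proof -
    have "2 / sqrt pi * (3 * e) \<le> 2 * (3 * e)"
      using e pi_ge_two by (intro mult_right_mono) (auto simp: field_simps)
    then have "2 / sqrt pi - \<delta> \<le> 2 / sqrt pi * (1 - 3 * e)"
      using e by (simp add: right_diff_distrib)
    also have "\<dots> \<le> 2 / sqrt pi * (1 - e) ^ 3"
    proof (intro mult_left_mono)
      show "1 - 3 * e \<le> (1 - e) ^ 3"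
        using Bernoulli_inequality[of "- e" 3] e by simp
    qed auto
    finally show ?thesis .
  qed
  then have density: "(2 / sqrt pi - \<delta>) * sqrt (real g * real n)
      \<le> 2 / sqrt pi * (1 - e) ^ 3 * sqrt (real g * real n)" for g n :: nat
    by (intro mult_right_mono) auto
  show ?thesis
  proof (intro exI[of _ "64 / e ^ 4"] allI impI)
    fix g n :: nat
    assume "g > 0" "n > 0" and log: "real g / ln (real n) > 64 / e ^ 4" and ratio: "real n / real g > 64 / e ^ 4"
    have "0 < 64 / e ^ 4"
      using e by simp
    then have ln: "0 < ln (real n)"
      using log \<open>n > 0\<close> by (smt (verit) divide_nonneg_nonpos of_nat_0_le_iff)
    have "4 / e\<^sup>2 \<le> 64 / e ^ 4"
    proof -
      have "e ^ 4 \<le> e\<^sup>2"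
        using e by (intro power_decreasing) auto
      then have "4 * e ^ 4 \<le> 64 * e\<^sup>2"
        using zero_le_power2[of e] by linarith
      then show ?thesis
        using e by (simp add: divide_le_eq le_divide_eq)
    qed
    then have "4 / e\<^sup>2 * ln (real n) \<le> 64 / e ^ 4 * ln (real n)"
      using ln by (intro mult_right_mono) auto
    also have "\<dots> < real g"
      using log ln by (simp add: field_simps)
    finally have "4 / e\<^sup>2 * ln (real n) < real g" .
    then obtain S where S: "S \<subseteq> {1..int n}" "bstar_set g S"
      "2 / sqrt pi * (1 - e) ^ 3 * sqrt (real g * real n) < real (card S)"
      using exists_bstar_set[OF e(1,2) \<open>g > 0\<close> \<open>n > 0\<close> ratio] by blast
    have "card S \<le> R g n"
      unfolding R_def using S finite_bstar_subsets by (intro Max_ge) auto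
    then show "real (R g n) > (2 / sqrt pi - \<delta>) * sqrt (real g * real n)"
      using S(3) density[of g n] by linarith
  qed
qed

end
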